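(* Let $\phi:M\to N$ be a smooth map from a compact, oriented $4$-dimensional Riemannian manifold $(M,g)$ to a compact Kähler manifold $(N,h,J)$ with Kähler form $\omega=h(J\cdot,\cdot)$. Then the functional $E(\phi)=\frac12\int_M|\phi^*\omega|^2\,{\ast 1}$, and therefore also its Euler-Lagrange equation, is invariant under conformal changes of the metric on $M$: if $g$ is replaced by $\tilde g=\lambda^2 g$ for a smooth positive function $\lambda$ on $M$, then the value of $E(\phi)$ is unchanged, and $\phi$ is a critical point of $E$ with respect to $\tilde g$ if and only if it is a critical point of $E$ with respect to $g$.
   Context: Here $\ast 1$ is the Riemannian volume form of $M$, and the pointwise norm on $p$-forms is induced by $\langle\alpha,\beta\rangle=\frac1{p!}\sum_{i_1,\dots,i_p}\alpha(e_{i_1},\dots,e_{i_p})\beta(e_{i_1},\dots,e_{i_p})$ for a local orthonormal frame $e_i$, so that $E(\phi)=\frac12\int_M\phi^*\omega\wedge\ast\phi^*\omega$. A map $\phi$ is a critical point of $E$ if $\frac{d}{dt}E(\phi_t)|_{t=0}=0$ for every smooth variation $\phi_t$ of $\phi=\phi_0$. *)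

theory Defs
  imports "HOL-Analysis.Analysis"
begin

section \<open>Smooth maps between Euclidean spaces\<close>

text \<open>\<open>Ck_on k f S\<close> is only meant for open \<open>S\<close>, where it says that \<open>f\<close> is \<open>k\<close> times continuously
  differentiable: all iterated directional derivatives of order at most \<open>k\<close> exist and are continuous.\<close>

primrec Ck_on ::
  "nat \<Rightarrow> ('a::real_normed_vector \<Rightarrow> 'b::real_normed_vector) \<Rightarrow> 'a set \<Rightarrow> bool" where
  "Ck_on 0 f S \<longleftrightarrow> continuous_on S f"
| "Ck_on (Suc k) f S \<longleftrightarrow>
     (\<forall>x\<in>S. f differentiable (at x)) \<and> (\<forall>v. Ck_on k (\<lambda>x. frechet_derivative f (at x) v) S)"

definition smooth_on ::
  "('a::real_normed_vector \<Rightarrow> 'b::real_normed_vector) \<Rightarrow> 'a set \<Rightarrow> bool" where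
  "smooth_on f S \<longleftrightarrow> (\<forall>k. Ck_on k f S)"

section \<open>Manifolds, given by a topological space and an atlas\<close>

text \<open>A chart is a pair \<open>(U, x)\<close> of a coordinate domain and a coordinate map; values of the
  coordinate map outside the domain are irrelevant.\<close>

type_synonym ('m, 'e) chart = "'m set \<times> ('m \<Rightarrow> 'e)"

abbreviation chart_dom :: "('m, 'e) chart \<Rightarrow> 'm set" where
  "chart_dom \<equiv> fst"

abbreviation chart_map :: "('m, 'e) chart \<Rightarrow> 'm \<Rightarrow> 'e" where
  "chart_map \<equiv> snd"

abbreviation chart_img :: "('m, 'e) chart \<Rightarrow> 'e set" where
  "chart_img c \<equiv> chart_map c ` chart_dom c"

definition chart_inv :: "('m, 'e) chart \<Rightarrow> 'e \<Rightarrow> 'm" where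
  "chart_inv c = inv_into (chart_dom c) (chart_map c)"

definition transition :: "('m, 'e) chart \<Rightarrow> ('m, 'e) chart \<Rightarrow> 'e \<Rightarrow> 'e" where
  "transition c d = chart_map d \<circ> chart_inv c"

definition is_chart :: "'m topology \<Rightarrow> ('m, 'e::euclidean_space) chart \<Rightarrow> bool" where
  "is_chart X c \<longleftrightarrow> openin X (chart_dom c) \<and> open (chart_img c) \<and>
     homeomorphic_map (subtopology X (chart_dom c)) (top_of_set (chart_img c)) (chart_map c)"

definition smooth_manifold :: "'m topology \<Rightarrow> ('m, 'e::euclidean_space) chart set \<Rightarrow> bool" where
  "smooth_manifold X A \<longleftrightarrow>
     Hausdorff_space X \<and> second_countable X \<and>
     (\<forall>c\<in>A. is_chart X c) \<and> (\<Union>c\<in>A. chart_dom c) = topspace X \<and>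
     (\<forall>c\<in>A. \<forall>d\<in>A. smooth_on (transition c d) (chart_map c ` (chart_dom c \<inter> chart_dom d)))"

text \<open>The differential at \<open>p\<close> of the change of coordinates from \<open>c\<close> to \<open>d\<close>.\<close>

definition dtransition ::
  "('m, 'e::euclidean_space) chart \<Rightarrow> ('m, 'e) chart \<Rightarrow> 'm \<Rightarrow> 'e \<Rightarrow> 'e" where
  "dtransition c d p = frechet_derivative (transition c d) (at (chart_map c p))"

text \<open>An orientation is given by an atlas of (positively oriented) charts with positive Jacobians.\<close>

definition oriented_manifold :: "'m topology \<Rightarrow> ('m, real^'d) chart set \<Rightarrow> bool" where
  "oriented_manifold X A \<longleftrightarrow> smooth_manifold X A \<and>
     (\<forall>c\<in>A. \<forall>d\<in>A. \<forall>p\<in>chart_dom c \<inter> chart_dom d. det (matrix (dtransition c d p)) > 0)"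

text \<open>Complex manifolds are given by a holomorphic atlas. In a holomorphic chart the complex
  structure \<open>J\<close> of the tangent spaces is multiplication by \<open>\<i>\<close>; it does not depend on the chart,
  since the coordinate changes have complex linear differentials.\<close>

definition std_J :: "complex^'k \<Rightarrow> complex^'k" where
  "std_J v = \<i> *s v"

definition complex_manifold :: "'m topology \<Rightarrow> ('m, complex^'k) chart set \<Rightarrow> bool" where
  "complex_manifold X A \<longleftrightarrow> smooth_manifold X A \<and>
     (\<forall>c\<in>A. \<forall>d\<in>A. \<forall>p\<in>chart_dom c \<inter> chart_dom d. \<forall>v.
        dtransition c d p (std_J v) = std_J (dtransition c d p v))"

section \<open>Smooth maps and variations\<close>

definition smooth_function ::
  "('m, 'e::euclidean_space) chart set \<Rightarrow> ('m \<Rightarrow> real) \<Rightarrow> bool" where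
  "smooth_function A f \<longleftrightarrow> (\<forall>c\<in>A. smooth_on (f \<circ> chart_inv c) (chart_img c))"

text \<open>Continuity makes the set on which the coordinate expression is considered open.\<close>

definition smooth_map ::
  "'m topology \<Rightarrow> ('m, 'e::euclidean_space) chart set \<Rightarrow>
   'n topology \<Rightarrow> ('n, 'f::euclidean_space) chart set \<Rightarrow> ('m \<Rightarrow> 'n) \<Rightarrow> bool" where
  "smooth_map X A Y B \<phi> \<longleftrightarrow> continuous_map X Y \<phi> \<and>
     (\<forall>c\<in>A. \<forall>d\<in>B. smooth_on (chart_map d \<circ> \<phi> \<circ> chart_inv c)
        {y \<in> chart_img c. \<phi> (chart_inv c y) \<in> chart_dom d})"

text \<open>A smooth variation is a smooth map \<open>(-\<epsilon>, \<epsilon>) \<times> M \<rightarrow> N\<close>, where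
  \<open>(-\<epsilon>, \<epsilon>) \<times> M\<close> carries the product charts. The value of \<open>\<Phi> t\<close> for other \<open>t\<close> is irrelevant.\<close>

definition smooth_variation ::
  "'m topology \<Rightarrow> ('m, 'e::euclidean_space) chart set \<Rightarrow>
   'n topology \<Rightarrow> ('n, 'f::euclidean_space) chart set \<Rightarrow>
   ('m \<Rightarrow> 'n) \<Rightarrow> (real \<Rightarrow> 'm \<Rightarrow> 'n) \<Rightarrow> bool" where
  "smooth_variation X A Y B \<phi> \<Phi> \<longleftrightarrow> (\<forall>p\<in>topspace X. \<Phi> 0 p = \<phi> p) \<and>
     (\<exists>\<epsilon>>0.
        continuous_map (prod_topology (top_of_set {-\<epsilon><..<\<epsilon>}) X) Y (\<lambda>(t, p). \<Phi> t p) \<and>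
        (\<forall>c\<in>A. \<forall>d\<in>B. smooth_on (\<lambda>(t, y). chart_map d (\<Phi> t (chart_inv c y)))
           {(t, y). t \<in> {-\<epsilon><..<\<epsilon>} \<and> y \<in> chart_img c \<and> \<Phi> t (chart_inv c y) \<in> chart_dom d}))"

definition critical_point ::
  "'m topology \<Rightarrow> ('m, 'e::euclidean_space) chart set \<Rightarrow>
   'n topology \<Rightarrow> ('n, 'f::euclidean_space) chart set \<Rightarrow>
   (('m \<Rightarrow> 'n) \<Rightarrow> real) \<Rightarrow> ('m \<Rightarrow> 'n) \<Rightarrow> bool" where
  "critical_point X A Y B F \<phi> \<longleftrightarrow>
     (\<forall>\<Phi>. smooth_variation X A Y B \<phi> \<Phi> \<longrightarrow> ((\<lambda>t. F (\<Phi> t)) has_real_derivative 0) (at 0))"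

section \<open>Tensor fields\<close>

text \<open>A covariant 2-tensor field \<open>T\<close> is given by its coordinate representations: \<open>T c p\<close> is the
  bilinear form at the point \<open>p\<close>, expressed in the coordinates of the chart \<open>c\<close> around \<open>p\<close>.
  The representations in two charts are related by the differential of the coordinate change.\<close>

type_synonym ('m, 'e) tensor2 = "('m, 'e) chart \<Rightarrow> 'm \<Rightarrow> 'e \<Rightarrow> 'e \<Rightarrow> real"

definition smooth_tensor2 ::
  "('m, 'e::euclidean_space) chart set \<Rightarrow> ('m, 'e) tensor2 \<Rightarrow> bool" where
  "smooth_tensor2 A T \<longleftrightarrow>
     (\<forall>c\<in>A. \<forall>p\<in>chart_dom c. bilinear (T c p)) \<and>
     (\<forall>c\<in>A. \<forall>v w. smooth_on (\<lambda>y. T c (chart_inv c y) v w) (chart_img c)) \<and>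
     (\<forall>c\<in>A. \<forall>d\<in>A. \<forall>p\<in>chart_dom c \<inter> chart_dom d. \<forall>v w.
        T c p v w = T d p (dtransition c d p v) (dtransition c d p w))"

definition riemannian_metric ::
  "('m, 'e::euclidean_space) chart set \<Rightarrow> ('m, 'e) tensor2 \<Rightarrow> bool" where
  "riemannian_metric A g \<longleftrightarrow> smooth_tensor2 A g \<and>
     (\<forall>c\<in>A. \<forall>p\<in>chart_dom c.
        (\<forall>v w. g c p v w = g c p w v) \<and> (\<forall>v. v \<noteq> 0 \<longrightarrow> g c p v v > 0))"

definition conformal_change ::
  "('m \<Rightarrow> real) \<Rightarrow> ('m, 'e) tensor2 \<Rightarrow> ('m, 'e) tensor2" where
  "conformal_change f g = (\<lambda>c p v w. (f p)\<^sup>2 * g c p v w)"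

text \<open>A 2-form is closed if in every chart
  \<open>d\<omega>(u,v,w) = \<partial>\<^sub>u \<omega>(v,w) - \<partial>\<^sub>v \<omega>(u,w) + \<partial>\<^sub>w \<omega>(u,v)\<close> vanishes, for constant
  coordinate fields \<open>u, v, w\<close>.\<close>

definition closed_form2 ::
  "('m, 'e::euclidean_space) chart set \<Rightarrow> ('m, 'e) tensor2 \<Rightarrow> bool" where
  "closed_form2 A \<omega> \<longleftrightarrow> (\<forall>c\<in>A. \<forall>y\<in>chart_img c. \<forall>u v w.
     (let D = (\<lambda>a b e. frechet_derivative (\<lambda>z. \<omega> c (chart_inv c z) b e) (at y) a)
      in D u v w - D v u w + D w u v = 0))"

definition kaehler_form :: "('n, complex^'k) tensor2 \<Rightarrow> ('n, complex^'k) tensor2" where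
  "kaehler_form h = (\<lambda>d q v w. h d q (std_J v) w)"

definition kaehler_manifold ::
  "'n topology \<Rightarrow> ('n, complex^'k) chart set \<Rightarrow> ('n, complex^'k) tensor2 \<Rightarrow> bool" where
  "kaehler_manifold Y B h \<longleftrightarrow> complex_manifold Y B \<and> riemannian_metric B h \<and>
     (\<forall>d\<in>B. \<forall>q\<in>chart_dom d. \<forall>v w. h d q (std_J v) (std_J w) = h d q v w) \<and>
     closed_form2 B (kaehler_form h)"

text \<open>The chart of the target used to express the pullback is arbitrary; by the transformation law
  of \<open>\<omega>\<close> the pullback does not depend on it.\<close>

definition pullback2 ::
  "('n, 'f::euclidean_space) chart set \<Rightarrow> ('m \<Rightarrow> 'n) \<Rightarrow> ('n, 'f) tensor2 \<Rightarrow>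
   ('m, 'e::euclidean_space) tensor2" where
  "pullback2 B \<phi> \<omega> = (\<lambda>c p v w.
     (let d = (SOME d. d \<in> B \<and> \<phi> p \<in> chart_dom d);
          D = frechet_derivative (chart_map d \<circ> \<phi> \<circ> chart_inv c) (at (chart_map c p))
      in \<omega> d (\<phi> p) (D v) (D w)))"

section \<open>Norm of 2-forms, volume form, integration\<close>

definition orthonormal_frame ::
  "(real^'d \<Rightarrow> real^'d \<Rightarrow> real) \<Rightarrow> ('d \<Rightarrow> real^'d) \<Rightarrow> bool" where
  "orthonormal_frame G e \<longleftrightarrow> (\<forall>i j. G (e i) (e j) = (if i = j then 1 else 0))"

text \<open>The choice of the orthonormal frame does not matter.\<close>

definition form2_inner ::
  "(real^'d \<Rightarrow> real^'d \<Rightarrow> real) \<Rightarrow>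
   (real^'d \<Rightarrow> real^'d \<Rightarrow> real) \<Rightarrow> (real^'d \<Rightarrow> real^'d \<Rightarrow> real) \<Rightarrow> real" where
  "form2_inner G \<alpha> \<beta> =
     (let e = (SOME e. orthonormal_frame G e)
      in 1 / fact 2 * (\<Sum>i\<in>UNIV. \<Sum>j\<in>UNIV. \<alpha> (e i) (e j) * \<beta> (e i) (e j)))"

definition form2_norm ::
  "(real^'d \<Rightarrow> real^'d \<Rightarrow> real) \<Rightarrow> (real^'d \<Rightarrow> real^'d \<Rightarrow> real) \<Rightarrow> real" where
  "form2_norm G \<alpha> = sqrt (form2_inner G \<alpha> \<alpha>)"

text \<open>A form of top degree, in coordinates, takes a family of \<open>CARD('d)\<close> tangent vectors.\<close>

type_synonym ('m, 'd) top_form = "('m, real^'d) chart \<Rightarrow> 'm \<Rightarrow> ('d \<Rightarrow> real^'d) \<Rightarrow> real"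

text \<open>\<open>*1 = sqrt (det (g\<^sub>i\<^sub>j)) dx\<^sub>1 \<and> \<dots> \<and> dx\<^sub>n\<close> in positively oriented coordinates.\<close>

definition volume_form :: "('m, real^'d) tensor2 \<Rightarrow> ('m, 'd) top_form" where
  "volume_form g = (\<lambda>c p v.
     sqrt (det (\<chi> i j. g c p (axis i 1) (axis j 1))) * det (\<chi> i. v i))"

text \<open>A finite smooth partition of unity, subordinate to charts of the atlas; the supports are closed.\<close>

definition partition_of_unity ::
  "'m topology \<Rightarrow> ('m, 'e::euclidean_space) chart set \<Rightarrow> ('m, 'e) chart set \<Rightarrow>
   (('m, 'e) chart \<Rightarrow> 'm \<Rightarrow> real) \<Rightarrow> bool" where
  "partition_of_unity X A C \<rho> \<longleftrightarrow> finite C \<and> C \<subseteq> A \<and>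
     (\<forall>c\<in>C. smooth_function A (\<rho> c) \<and> (\<forall>p\<in>topspace X. 0 \<le> \<rho> c p) \<and>
        X closure_of {p \<in> topspace X. \<rho> c p \<noteq> 0} \<subseteq> chart_dom c) \<and>
     (\<forall>p\<in>topspace X. (\<Sum>c\<in>C. \<rho> c p) = 1)"

text \<open>Integral of a continuous form of top degree over a compact oriented manifold. A partition of
  unity exists because the manifold is compact, and all of them give the same value.\<close>

definition form_integral ::
  "'m topology \<Rightarrow> ('m, real^'d) chart set \<Rightarrow> ('m, 'd) top_form \<Rightarrow> real" where
  "form_integral X A \<eta> =
     (THE I. \<exists>C \<rho>. partition_of_unity X A C \<rho> \<and>
        I = (\<Sum>c\<in>C. LINT y:chart_img c|lborel.
               \<rho> c (chart_inv c y) * \<eta> c (chart_inv c y) (\<lambda>i. axis i 1)))"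

section \<open>The functional\<close>

definition energy ::
  "'m topology \<Rightarrow> ('m, real^'d) chart set \<Rightarrow> ('m, real^'d) tensor2 \<Rightarrow>
   ('n, complex^'k) chart set \<Rightarrow> ('n, complex^'k) tensor2 \<Rightarrow> ('m \<Rightarrow> 'n) \<Rightarrow> real" where
  "energy X A g B h \<phi> = 1 / 2 * form_integral X A
     (\<lambda>c p v. (form2_norm (g c p) (pullback2 B \<phi> (kaehler_form h) c p))\<^sup>2 * volume_form g c p v)"

end

theory Submission
  imports Defs
begin

text \<open>If \<open>e\<close> is orthonormal for \<open>g\<close>, then \<open>\<lambda>\<^sup>-\<^sup>1 e\<close> is orthonormal for \<open>\<lambda>\<^sup>2 g\<close>, so the squared norm
  of a 2-form is multiplied by \<open>\<lambda>\<^sup>-\<^sup>4\<close> while the volume form is multiplied by \<open>\<lambda>\<^sup>n\<close>. In dimension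
  \<open>n = 4\<close> the two factors cancel pointwise, so the energies agree on every differentiable map, in
  particular on all members of a variation with small parameter.\<close>

section \<open>Orthonormal frames of an inner product on a coordinate space\<close>

text \<open>Gram-Schmidt, by induction on the finite set \<open>S\<close> of indices for which the
  frame vectors have already been constructed.\<close>

lemma orthonormal_frame_exists:
  fixes G :: "real^'d \<Rightarrow> real^'d \<Rightarrow> real"
  assumes bil: "bilinear G" and sym: "\<And>v w. G v w = G w v"
    and pos: "\<And>v. v \<noteq> 0 \<Longrightarrow> G v v > 0"
  shows "\<exists>e. orthonormal_frame G e"
proof -
  have "\<exists>e :: 'd \<Rightarrow> real^'d. \<forall>i\<in>S. \<forall>j\<in>S. G (e i) (e j) = (if i = j then 1 else 0)" for S :: "'d set"
  proof (induction S rule: infinite_finite_induct)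
    case (insert a S)
    then obtain e :: "'d \<Rightarrow> real^'d"
      where e: "\<And>i j. i \<in> S \<Longrightarrow> j \<in> S \<Longrightarrow> G (e i) (e j) = (if i = j then 1 else 0)"
      by blast
    \<comment> \<open>The index \<open>a\<close> is missing from \<open>S\<close>, so the vectors
      built so far cannot span and some \<open>v\<close> lies outside their span.\<close>
    have "dim (span (e ` S)) \<le> card (e ` S)"
      by (simp add: dim_le_card' dim_span)
    also have "\<dots> \<le> card S"
      by (simp add: card_image_le)
    also have "\<dots> < CARD('d)"
      using insert(2) by (intro psubset_card_mono) auto
    finally have "span (e ` S) \<noteq> UNIV"
      using dim_UNIV[where 'a = "real^'d"] by (auto simp del: dim_span)
    then obtain v where v: "v \<notin> span (e ` S)"
      by blast
    \<comment> \<open>The vector \<open>v\<close> minus its \<open>G\<close>-orthogonal projection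
      to the span; it is nonzero by the choice of \<open>v\<close>.\<close>
    define w where "w = v - (\<Sum>k\<in>S. G v (e k) *\<^sub>R e k)"
    have "(\<Sum>k\<in>S. G v (e k) *\<^sub>R e k) \<in> span (e ` S)"
      by (intro span_sum span_scale span_base imageI)
    with v have "w \<noteq> 0"
      by (auto simp: w_def)
    then have ww: "G w w > 0"
      by (rule pos)
    have we: "G w (e j) = 0" if "j \<in> S" for j
    proof -
      have "G w (e j) = G v (e j) - (\<Sum>k\<in>S. G v (e k) * G (e k) (e j))"
        by (simp add: w_def bilinear_lsub[OF bil] bilinear_lmul[OF bil]
            linear_sum[OF bil[unfolded bilinear_def, THEN conjunct2, rule_format]])
      also have "(\<Sum>k\<in>S. G v (e k) * G (e k) (e j)) = (\<Sum>k\<in>S. if k = j then G v (e k) else 0)"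
        using that by (intro sum.cong) (auto simp: e)
      also have "\<dots> = G v (e j)"
        using that insert(1) by simp
      finally show ?thesis by simp
    qed
    define u where "u = (1 / sqrt (G w w)) *\<^sub>R w"
    have "G u u = 1"
      using ww by (simp add: u_def bilinear_lmul[OF bil] bilinear_rmul[OF bil] field_simps)
    moreover have "G u (e j) = 0" "G (e j) u = 0" if "j \<in> S" for j
      using we[OF that] sym[of "e j" u] by (simp_all add: u_def bilinear_lmul[OF bil])
    ultimately have "\<forall>i\<in>insert a S. \<forall>j\<in>insert a S.
        G ((e(a := u)) i) ((e(a := u)) j) = (if i = j then 1 else 0)"
      using insert(2) e by auto
    then show ?case by blast
  qed auto
  from this[of UNIV] show ?thesis
    by (auto simp: orthonormal_frame_def)
qed

text \<open>Orthonormality says that the coefficient map \<open>T\<close> is a left inverse of the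
  synthesis map \<open>S\<close>. In finite dimension it is then also a right inverse, which is the
  claim.\<close>

lemma orthonormal_frame_expansion:
  fixes G :: "real^'d \<Rightarrow> real^'d \<Rightarrow> real"
  assumes bil: "bilinear G" and e: "orthonormal_frame G e"
  shows "(\<Sum>k\<in>UNIV. G v (e k) *\<^sub>R e k) = v"
proof -
  define S :: "real^'d \<Rightarrow> real^'d" where "S c = (\<Sum>k\<in>UNIV. c $ k *\<^sub>R e k)" for c
  define T :: "real^'d \<Rightarrow> real^'d" where "T x = (\<chi> k. G x (e k))" for x
  have "linear S"
    by (rule linearI) (simp_all add: S_def scaleR_left_distrib sum.distrib scaleR_sum_right)
  have "linear T"
    by (rule linearI) (simp_all add: T_def vec_eq_iff bilinear_ladd[OF bil] bilinear_lmul[OF bil])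
  have "T (S c) = c" for c
  proof -
    have "G (\<Sum>k\<in>UNIV. c $ k *\<^sub>R e k) (e j) = (\<Sum>k\<in>UNIV. c $ k * G (e k) (e j))" for j
      by (simp add: bilinear_lmul[OF bil]
          linear_sum[OF bil[unfolded bilinear_def, THEN conjunct2, rule_format]])
    moreover have "(\<Sum>k\<in>UNIV. c $ k * G (e k) (e j)) = (\<Sum>k\<in>UNIV. if k = j then c $ k else 0)" for j
      using e by (intro sum.cong) (auto simp: orthonormal_frame_def)
    ultimately show ?thesis
      by (simp add: T_def S_def vec_eq_iff)
  qed
  then have "T \<circ> S = id"
    by auto
  then have "S \<circ> T = id"
    using \<open>linear S\<close> \<open>linear T\<close> linear_inverse_left by blast
  then have "S (T v) = v"
    by (metis comp_apply id_apply)
  then show ?thesis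
    by (simp add: S_def T_def)
qed

text \<open>Two orthonormal frames differ by an orthogonal matrix \<open>P\<close>. It carries the
  vector of values of \<open>f\<close> on \<open>e\<close> to the vector of values on
  \<open>e'\<close>, and it preserves the Euclidean norm.\<close>

lemma orthonormal_frame_sum_squares:
  fixes G :: "real^'d \<Rightarrow> real^'d \<Rightarrow> real" and f :: "real^'d \<Rightarrow> real"
  assumes bil: "bilinear G" and e: "orthonormal_frame G e" and e': "orthonormal_frame G e'"
    and f: "linear f"
  shows "(\<Sum>i\<in>UNIV. (f (e' i))\<^sup>2) = (\<Sum>i\<in>UNIV. (f (e i))\<^sup>2)"
proof -
  \<comment> \<open>Row \<open>i\<close> of \<open>P\<close> holds the coordinates of
    \<open>e' i\<close> in the frame \<open>e\<close>.\<close>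
  define P :: "real^'d^'d" where "P = (\<chi> i k. G (e' i) (e k))"
  define F :: "real^'d" where "F = (\<chi> k. f (e k))"
  have expand: "(\<Sum>k\<in>UNIV. P $ i $ k *\<^sub>R e k) = e' i" for i
    using orthonormal_frame_expansion[OF bil e] by (simp add: P_def)
  have "(\<Sum>k\<in>UNIV. P $ i $ k * P $ j $ k) = (if i = j then 1 else 0)" for i j
  proof -
    have "(\<Sum>k\<in>UNIV. P $ i $ k * P $ j $ k) = G (e' i) (\<Sum>k\<in>UNIV. P $ j $ k *\<^sub>R e k)"
      by (simp add: bilinear_rmul[OF bil] P_def mult.commute
          linear_sum[OF bil[unfolded bilinear_def, THEN conjunct1, rule_format]])
    then show ?thesis
      using e' by (simp add: expand orthonormal_frame_def)
  qed
  then have "P ** transpose P = mat 1"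
    by (simp add: vec_eq_iff matrix_matrix_mult_def transpose_def mat_def)
  then have "orthogonal_matrix P"
    by (simp add: orthogonal_matrix_def matrix_left_right_inverse)
  then have "orthogonal_transformation ((*v) P)"
    by (simp add: orthogonal_transformation_matrix)
  then have "norm (P *v F) = norm F"
    by (rule orthogonal_transformation_norm)
  then have "(\<Sum>i\<in>UNIV. ((P *v F) $ i)\<^sup>2) = (\<Sum>i\<in>UNIV. (F $ i)\<^sup>2)"
    by (simp add: norm_vec_def L2_set_def)
  moreover have "(P *v F) $ i = f (e' i)" for i
    by (simp add: F_def matrix_vector_mult_def linear_sum[OF f] linear_cmul[OF f] flip: expand)
  ultimately show ?thesis
    by (simp add: F_def)
qed

section \<open>Scaling of the norm of 2-forms and of the volume form\<close>

text \<open>Frees \<open>form2_inner\<close> from the frame chosen by \<open>SOME\<close>: the frame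
  is exchanged in one argument of \<open>\<alpha>\<close> at a time, the other argument being held
  fixed.\<close>

lemma form2_inner_eq_sum:
  fixes G :: "real^'d \<Rightarrow> real^'d \<Rightarrow> real"
  assumes bil: "bilinear G" and e: "orthonormal_frame G e" and \<alpha>: "bilinear \<alpha>"
  shows "form2_inner G \<alpha> \<alpha> = 1 / fact 2 * (\<Sum>i\<in>UNIV. \<Sum>j\<in>UNIV. (\<alpha> (e i) (e j))\<^sup>2)"
proof -
  define e' where "e' = (SOME e. orthonormal_frame G e)"
  have e': "orthonormal_frame G e'"
    unfolding e'_def by (rule someI[of "orthonormal_frame G", OF e])
  have lin: "linear (\<lambda>w. \<alpha> v w)" "linear (\<lambda>v. \<alpha> v w)" for v w
    using \<alpha> by (auto simp: bilinear_def)
  have "(\<Sum>i\<in>UNIV. \<Sum>j\<in>UNIV. (\<alpha> (e' i) (e' j))\<^sup>2) = (\<Sum>i\<in>UNIV. \<Sum>j\<in>UNIV. (\<alpha> (e' i) (e j))\<^sup>2)"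
    using orthonormal_frame_sum_squares[OF bil e e' lin(1)] by simp
  also have "\<dots> = (\<Sum>j\<in>UNIV. \<Sum>i\<in>UNIV. (\<alpha> (e' i) (e j))\<^sup>2)"
    by (rule sum.swap)
  also have "\<dots> = (\<Sum>j\<in>UNIV. \<Sum>i\<in>UNIV. (\<alpha> (e i) (e j))\<^sup>2)"
    using orthonormal_frame_sum_squares[OF bil e e' lin(2)] by simp
  also have "\<dots> = (\<Sum>i\<in>UNIV. \<Sum>j\<in>UNIV. (\<alpha> (e i) (e j))\<^sup>2)"
    by (rule sum.swap)
  finally show ?thesis
    by (simp add: form2_inner_def e'_def power2_eq_square Let_def)
qed

text \<open>Each of the two arguments of \<open>\<alpha>\<close> contributes a factor
  \<open>1 / l\<close> from the rescaled frame, and squaring gives the fourth power. The exponent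
  comes from the degree of the form, not from the dimension.\<close>

lemma form2_norm_scale:
  fixes G :: "real^'d \<Rightarrow> real^'d \<Rightarrow> real"
  assumes bil: "bilinear G" and sym: "\<And>v w. G v w = G w v"
    and pos: "\<And>v. v \<noteq> 0 \<Longrightarrow> G v v > 0" and \<alpha>: "bilinear \<alpha>" and l: "l > 0"
  shows "l ^ 4 * (form2_norm (\<lambda>v w. l\<^sup>2 * G v w) \<alpha>)\<^sup>2 = (form2_norm G \<alpha>)\<^sup>2"
proof -
  obtain e where e: "orthonormal_frame G e"
    using orthonormal_frame_exists[OF bil sym pos] by blast
  define e' where "e' i = (1 / l) *\<^sub>R e i" for i
  have e': "orthonormal_frame (\<lambda>v w. l\<^sup>2 * G v w) e'"
    using e l unfolding orthonormal_frame_def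
    by (simp add: e'_def bilinear_lmul[OF bil] bilinear_rmul[OF bil] power2_eq_square)
  have bil': "bilinear (\<lambda>v w. l\<^sup>2 * G v w)"
    using bil unfolding bilinear_def linear_iff by (simp add: algebra_simps)
  have "l ^ 4 * (\<alpha> (e' i) (e' j))\<^sup>2 = (\<alpha> (e i) (e j))\<^sup>2" for i j
    using l by (simp add: e'_def bilinear_lmul[OF \<alpha>] bilinear_rmul[OF \<alpha>] field_simps
        power2_eq_square power4_eq_xxxx)
  then have "l ^ 4 * form2_inner (\<lambda>v w. l\<^sup>2 * G v w) \<alpha> \<alpha> = form2_inner G \<alpha> \<alpha>"
    unfolding form2_inner_eq_sum[OF bil e \<alpha>] form2_inner_eq_sum[OF bil' e' \<alpha>]
    by (simp add: sum_distrib_left)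
  \<comment> \<open>Nonnegativity lets the square in the claim cancel the \<open>sqrt\<close> in
    \<open>form2_norm\<close>.\<close>
  moreover have "form2_inner G \<alpha> \<alpha> \<ge> 0" "form2_inner (\<lambda>v w. l\<^sup>2 * G v w) \<alpha> \<alpha> \<ge> 0"
    unfolding form2_inner_eq_sum[OF bil e \<alpha>] form2_inner_eq_sum[OF bil' e' \<alpha>]
    by (simp_all add: sum_nonneg)
  ultimately show ?thesis
    by (simp add: form2_norm_def)
qed

lemma det_scale:
  fixes M :: "real^'d^'d"
  shows "det (\<chi> i j. a * M $ i $ j) = a ^ CARD('d) * det M"
proof -
  have "(\<chi> i j. a * M $ i $ j) = (\<chi> i. a *s (M $ i))"
    by (simp add: vec_eq_iff)
  then show ?thesis
    by (simp add: det_rows_mul)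
qed

text \<open>The Gram determinant picks up one factor \<open>(f p)\<^sup>2\<close> per row; the
  square root of their product is a power of \<open>f p\<close> because \<open>f p\<close> is
  positive.\<close>

lemma volume_form_conformal_change:
  fixes g :: "('m, real^'d) tensor2"
  assumes "f p > 0"
  shows "volume_form (conformal_change f g) c p v = f p ^ CARD('d) * volume_form g c p v"
proof -
  have "sqrt (((f p)\<^sup>2) ^ CARD('d)) = f p ^ CARD('d)"
    using assms by (simp add: real_sqrt_power)
  then show ?thesis
    using det_scale[of "(f p)\<^sup>2" "\<chi> i j. g c p (axis i 1) (axis j 1)"]
    by (simp add: volume_form_def conformal_change_def real_sqrt_mult)
qed

section \<open>Differentiable maps and bilinearity of the pullback\<close>

lemma bilinear_compose_linear:
  assumes "bilinear h" and "linear f" and "linear k"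
  shows "bilinear (\<lambda>v w. h (f v) (k w))"
  using assms linear_compose[OF \<open>linear f\<close>] linear_compose[OF \<open>linear k\<close>]
  by (fastforce simp: bilinear_def o_def)

lemma linear_std_J: "linear (std_J :: complex^'k \<Rightarrow> complex^'k)"
  by (rule linearI) (simp_all add: std_J_def vec_eq_iff algebra_simps)

lemma bilinear_kaehler_form:
  assumes "bilinear (h d q)"
  shows "bilinear (kaehler_form h d q)"
  unfolding kaehler_form_def
  using bilinear_compose_linear[OF assms linear_std_J linear_id] by simp

lemma chart_inv_chart_map:
  assumes "is_chart X c" and "p \<in> chart_dom c"
  shows "chart_inv c (chart_map c p) = p"
proof -
  have "chart_dom c \<subseteq> topspace X"
    using assms(1) by (auto simp: is_chart_def dest: openin_subset)
  moreover have "inj_on (chart_map c) (topspace (subtopology X (chart_dom c)))"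
    using assms(1) homeomorphic_imp_injective_map unfolding is_chart_def by blast
  ultimately have "inj_on (chart_map c) (chart_dom c)"
    by (simp add: topspace_subtopology Int_absorb1)
  then show ?thesis
    using assms(2) by (simp add: chart_inv_def)
qed

text \<open>Away from points of differentiability \<^const>\<open>frechet_derivative\<close> is an arbitrary, possibly
  nonlinear function; the norm of the pullback would then depend on the chosen frame.\<close>

definition diff_map ::
  "'m topology \<Rightarrow> ('m, 'e::euclidean_space) chart set \<Rightarrow>
   'n topology \<Rightarrow> ('n, 'f::euclidean_space) chart set \<Rightarrow> ('m \<Rightarrow> 'n) \<Rightarrow> bool" where
  "diff_map X A Y B \<psi> \<longleftrightarrow> (\<forall>p\<in>topspace X. \<psi> p \<in> topspace Y) \<and>
     (\<forall>c\<in>A. \<forall>d\<in>B. \<forall>p\<in>chart_dom c. \<psi> p \<in> chart_dom d \<longrightarrow>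
        (chart_map d \<circ> \<psi> \<circ> chart_inv c) differentiable (at (chart_map c p)))"

lemma smooth_on_differentiable: "smooth_on f S \<Longrightarrow> x \<in> S \<Longrightarrow> f differentiable (at x)"
  unfolding smooth_on_def by (metis Ck_on.simps(2))

lemma smooth_map_imp_diff_map:
  assumes X: "smooth_manifold X A" and \<phi>: "smooth_map X A Y B \<phi>"
  shows "diff_map X A Y B \<phi>"
  unfolding diff_map_def
proof (intro conjI ballI impI)
  show "\<phi> p \<in> topspace Y" if "p \<in> topspace X" for p
    using \<phi> that by (auto simp: smooth_map_def dest: continuous_map_image_subset_topspace)
next
  fix c d p
  assume cd: "c \<in> A" "d \<in> B" and p: "p \<in> chart_dom c" "\<phi> p \<in> chart_dom d"
  have "chart_inv c (chart_map c p) = p"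
    using X cd p by (auto simp: smooth_manifold_def intro: chart_inv_chart_map)
  with \<phi> cd p show "(chart_map d \<circ> \<phi> \<circ> chart_inv c) differentiable (at (chart_map c p))"
    by (auto simp: smooth_map_def intro!: smooth_on_differentiable)
qed

text \<open>Smoothness is joint in time and space, so each time slice is a composition with
  \<open>y \<mapsto> (t, y)\<close>. Only times within \<open>\<epsilon>\<close> of 0 are
  controlled, hence the eventual statement.\<close>

lemma smooth_variation_imp_diff_map:
  assumes X: "smooth_manifold X A" and \<Phi>: "smooth_variation X A Y B \<phi> \<Phi>"
  shows "eventually (\<lambda>t. diff_map X A Y B (\<Phi> t)) (nhds 0)"
proof -
  obtain \<epsilon> where \<epsilon>: "\<epsilon> > 0"
    and cont: "continuous_map (prod_topology (top_of_set {-\<epsilon><..<\<epsilon>}) X) Y (\<lambda>(t, p). \<Phi> t p)"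
    and smooth: "\<And>c d. c \<in> A \<Longrightarrow> d \<in> B \<Longrightarrow>
      smooth_on (\<lambda>(t, y). chart_map d (\<Phi> t (chart_inv c y)))
        {(t, y). t \<in> {-\<epsilon><..<\<epsilon>} \<and> y \<in> chart_img c \<and> \<Phi> t (chart_inv c y) \<in> chart_dom d}"
    using \<Phi> unfolding smooth_variation_def by blast
  have "diff_map X A Y B (\<Phi> t)" if t: "t \<in> {-\<epsilon><..<\<epsilon>}" for t
    unfolding diff_map_def
  proof (intro conjI ballI impI)
    show "\<Phi> t p \<in> topspace Y" if "p \<in> topspace X" for p
      using continuous_map_image_subset_topspace[OF cont] t that
      by (auto simp: image_subset_iff)
  next
    fix c d p
    assume cd: "c \<in> A" "d \<in> B" and p: "p \<in> chart_dom c" "\<Phi> t p \<in> chart_dom d"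
    have inv: "chart_inv c (chart_map c p) = p"
      using X cd p by (auto simp: smooth_manifold_def intro: chart_inv_chart_map)
    have "(\<lambda>(t, y). chart_map d (\<Phi> t (chart_inv c y))) differentiable (at (t, chart_map c p))"
      using t p inv by (intro smooth_on_differentiable[OF smooth[OF cd]]) auto
    moreover have "(\<lambda>y. (t, y)) differentiable (at (chart_map c p))"
      by (rule differentiableI) (auto intro!: derivative_eq_intros)
    ultimately have "((\<lambda>(t, y). chart_map d (\<Phi> t (chart_inv c y))) \<circ> (\<lambda>y. (t, y)))
        differentiable (at (chart_map c p))"
      by (intro differentiable_chain_at)
    then show "(chart_map d \<circ> \<Phi> t \<circ> chart_inv c) differentiable (at (chart_map c p))"
      by (simp add: o_def)
  qed
  moreover have "eventually (\<lambda>t. t \<in> {-\<epsilon><..<\<epsilon>}) (nhds 0)"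
    using \<epsilon> by (intro eventually_nhds_in_open) auto
  ultimately show ?thesis
    by (rule eventually_mono[rotated])
qed

lemma bilinear_pullback2:
  assumes Y: "smooth_manifold Y B" and \<psi>: "diff_map X A Y B \<psi>"
    and \<omega>: "\<And>d q. d \<in> B \<Longrightarrow> q \<in> chart_dom d \<Longrightarrow> bilinear (\<omega> d q)"
    and c: "c \<in> A" and p: "p \<in> chart_dom c" "p \<in> topspace X"
  shows "bilinear (pullback2 B \<psi> \<omega> c p)"
proof -
  \<comment> \<open>The target chart that \<open>pullback2\<close> selects; one exists because the
    charts in \<open>B\<close> cover \<open>topspace Y\<close>.\<close>
  define d where "d = (SOME d. d \<in> B \<and> \<psi> p \<in> chart_dom d)"
  have "\<psi> p \<in> topspace Y"
    using \<psi> p by (auto simp: diff_map_def)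
  moreover have "(\<Union>d\<in>B. chart_dom d) = topspace Y"
    using Y by (simp add: smooth_manifold_def)
  ultimately have "\<exists>d. d \<in> B \<and> \<psi> p \<in> chart_dom d"
    by blast
  then have d: "d \<in> B" "\<psi> p \<in> chart_dom d"
    unfolding d_def by (metis (mono_tags, lifting) someI_ex)+
  have "linear (frechet_derivative (chart_map d \<circ> \<psi> \<circ> chart_inv c) (at (chart_map c p)))"
    using \<psi> c p d by (auto simp: diff_map_def intro!: linear_frechet_derivative)
  from bilinear_compose_linear[OF \<omega>[OF d] this this] show ?thesis
    by (simp only: pullback2_def Let_def d_def)
qed

section \<open>Invariance of the energy and of its critical points\<close>

text \<open>For each partition of unity the two sums of integrals agree, so both \<open>THE\<close>
  descriptions have the same defining predicate.\<close>

lemma form_integral_cong: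
  assumes "\<And>c p v. c \<in> A \<Longrightarrow> p \<in> chart_dom c \<Longrightarrow> \<eta> c p v = \<theta> c p v"
  shows "form_integral X A \<eta> = form_integral X A \<theta>"
proof -
  have "(LINT y:chart_img c|lborel. r (chart_inv c y) * \<eta> c (chart_inv c y) (\<lambda>i. axis i 1)) =
        (LINT y:chart_img c|lborel. r (chart_inv c y) * \<theta> c (chart_inv c y) (\<lambda>i. axis i 1))"
    if "c \<in> A" for c and r :: "_ \<Rightarrow> real"
    unfolding set_lebesgue_integral_def
    using that by (intro Bochner_Integration.integral_cong)
      (auto simp: indicator_def chart_inv_def inv_into_into assms)
  then have "(\<Sum>c\<in>C. LINT y:chart_img c|lborel.
        \<rho> c (chart_inv c y) * \<eta> c (chart_inv c y) (\<lambda>i. axis i 1)) =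
      (\<Sum>c\<in>C. LINT y:chart_img c|lborel.
        \<rho> c (chart_inv c y) * \<theta> c (chart_inv c y) (\<lambda>i. axis i 1))"
    if "partition_of_unity X A C \<rho>" for C \<rho>
    using that by (intro sum.cong) (auto simp: partition_of_unity_def)
  then show ?thesis
    unfolding form_integral_def by (metis (no_types, lifting))
qed

lemma energy_conformal_change:
  fixes X :: "'m topology" and A :: "('m, real^4) chart set"
  assumes X: "smooth_manifold X A" and g: "riemannian_metric A g"
    and Y: "kaehler_manifold Y B h" and \<psi>: "diff_map X A Y B \<psi>"
    and f: "\<And>p. p \<in> topspace X \<Longrightarrow> f p > 0"
  shows "energy X A (conformal_change f g) B h \<psi> = energy X A g B h \<psi>"
proof -
  have "(form2_norm (conformal_change f g c p) (pullback2 B \<psi> (kaehler_form h) c p))\<^sup>2 *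
          volume_form (conformal_change f g) c p v =
        (form2_norm (g c p) (pullback2 B \<psi> (kaehler_form h) c p))\<^sup>2 * volume_form g c p v"
    if c: "c \<in> A" and p: "p \<in> chart_dom c" for c p v
  proof -
    have pX: "p \<in> topspace X"
      using X c p by (auto simp: smooth_manifold_def)
    have \<alpha>: "bilinear (pullback2 B \<psi> (kaehler_form h) c p)"
    proof (rule bilinear_pullback2[OF _ \<psi> _ c p pX])
      show "smooth_manifold Y B"
        using Y by (simp add: kaehler_manifold_def complex_manifold_def)
      show "bilinear (kaehler_form h d q)" if "d \<in> B" "q \<in> chart_dom d" for d q
        using Y that unfolding kaehler_manifold_def riemannian_metric_def smooth_tensor2_def
        by (intro bilinear_kaehler_form) blast
    qed
    have G: "bilinear (g c p)" "\<And>v w. g c p v w = g c p w v" "\<And>v. v \<noteq> 0 \<Longrightarrow> g c p v v > 0"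
      using g c p unfolding riemannian_metric_def smooth_tensor2_def by blast+
    have norm: "f p ^ 4 * (form2_norm (conformal_change f g c p) (pullback2 B \<psi> (kaehler_form h) c p))\<^sup>2 =
        (form2_norm (g c p) (pullback2 B \<psi> (kaehler_form h) c p))\<^sup>2"
      unfolding conformal_change_def by (rule form2_norm_scale[OF G \<alpha> f[OF pX]])
    \<comment> \<open>Here the dimension enters: \<open>CARD(4)\<close> evaluates to 4, the exponent
      in \<open>norm\<close>.\<close>
    have vol: "volume_form (conformal_change f g) c p v = f p ^ 4 * volume_form g c p v"
      using volume_form_conformal_change[of f p g c v, OF f[OF pX]] by simp
    show ?thesis
      unfolding vol norm[symmetric] by simp
  qed
  then show ?thesis
    unfolding energy_def by (intro arg_cong[where f = "(*) (1 / 2)"] form_integral_cong)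
qed

text \<open>A derivative at 0 depends only on the germ at 0. The filter is \<open>nhds 0\<close>
  because the value at 0 itself enters the difference quotient.\<close>

lemma critical_point_cong:
  assumes "\<And>\<Phi>. smooth_variation X A Y B \<phi> \<Phi> \<Longrightarrow> eventually (\<lambda>t. F (\<Phi> t) = F' (\<Phi> t)) (nhds 0)"
  shows "critical_point X A Y B F \<phi> \<longleftrightarrow> critical_point X A Y B F' \<phi>"
proof -
  have "((\<lambda>t. F (\<Phi> t)) has_real_derivative 0) (at 0) \<longleftrightarrow>
      ((\<lambda>t. F' (\<Phi> t)) has_real_derivative 0) (at 0)"
    if "smooth_variation X A Y B \<phi> \<Phi>" for \<Phi>
    by (rule DERIV_cong_ev[OF refl assms[OF that] refl])
  then show ?thesis
    by (simp add: critical_point_def)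
qed

theorem proposition2p1:
  fixes X :: "'m topology" and A :: "('m, real^4) chart set" and g :: "('m, real^4) tensor2"
    and Y :: "'n topology" and B :: "('n, complex^'k) chart set" and h :: "('n, complex^'k) tensor2"
    and \<phi> :: "'m \<Rightarrow> 'n" and lam :: "'m \<Rightarrow> real"
  assumes "oriented_manifold X A" and "compact_space X" and "riemannian_metric A g"
    and "kaehler_manifold Y B h" and "compact_space Y"
    and "smooth_map X A Y B \<phi>"
    and "smooth_function A lam" and "\<forall>p\<in>topspace X. lam p > 0"
  shows "energy X A (conformal_change lam g) B h \<phi> = energy X A g B h \<phi> \<and>
         (critical_point X A Y B (energy X A (conformal_change lam g) B h) \<phi> \<longleftrightarrow>
          critical_point X A Y B (energy X A g B h) \<phi>)"
proof -
  have X: "smooth_manifold X A"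
    using assms(1) by (simp add: oriented_manifold_def)
  \<comment> \<open>Stated for all \<open>\<psi>\<close>, since criticality compares the energies
    along whole variations and not only at \<open>\<phi>\<close>.\<close>
  have E: "energy X A (conformal_change lam g) B h \<psi> = energy X A g B h \<psi>"
    if "diff_map X A Y B \<psi>" for \<psi>
    using energy_conformal_change[OF X assms(3,4) that] assms(8) by blast
  show ?thesis
  proof
    show "energy X A (conformal_change lam g) B h \<phi> = energy X A g B h \<phi>"
      by (rule E[OF smooth_map_imp_diff_map[OF X assms(6)]])
    show "critical_point X A Y B (energy X A (conformal_change lam g) B h) \<phi> \<longleftrightarrow>
          critical_point X A Y B (energy X A g B h) \<phi>"
      by (rule critical_point_cong)
        (use smooth_variation_imp_diff_map[OF X] E in \<open>blast intro: eventually_mono\<close>)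
  qed
qed

end
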